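(* Let $\mathrm{a}_{n,k}^{\mathrm{ddes}}(123,132)$ denote the number of permutations of $\{1,\dots,n\}$ that avoid both $123$ and $132$ and have exactly $k$ double descents. Then for all integers $n\ge3$ and $k\ge0$, $$\mathrm{a}_{n,k}^{\mathrm{ddes}}(123,132)=\binom{n-2}{k}+2\binom{n-3}{k}.$$
   Context: $\mathcal{S}_n$ is the set of permutations $\pi=\pi_1\cdots\pi_n$ of $\{1,\dots,n\}$. For $\rho\in\mathcal{S}_m$, $\pi\in\mathcal{S}_n$ contains $\rho$ if there are indices $1\le i_1<\cdots<i_m\le n$ such that $\pi_{i_a}<\pi_{i_b}$ if and only if $\rho_a<\rho_b$; otherwise $\pi$ avoids $\rho$. The number of double descents is $\mathrm{ddes}(\pi)=|\{i:\pi_i>\pi_{i+1}>\pi_{i+2}\}|$, where $1\le i\le n-2$. Binomial coefficients $\binom{m}{j}$ with $j>m\ge 0$ are $0$. *)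

theory Defs
  imports "HOL-Combinatorics.Multiset_Permutations"
begin

text \<open>
  A permutation of \<open>{1..n}\<close> is represented by its one-line notation, a list in
  \<open>permutations_of_set {1..n}\<close>. List positions count from 0, so the \<open>i\<close>-th letter
  of \<open>\<pi>\<close> (for \<open>1 \<le> i \<le> n\<close>) is \<open>\<pi> ! (i - 1)\<close>.
\<close>

definition contains_pattern :: "nat list \<Rightarrow> nat list \<Rightarrow> bool" where
  "contains_pattern \<pi> \<rho> \<longleftrightarrow>
     (\<exists>i :: nat \<Rightarrow> nat. strict_mono_on {..<length \<rho>} i \<and>
        (\<forall>a<length \<rho>. i a < length \<pi>) \<and>
        (\<forall>a<length \<rho>. \<forall>b<length \<rho>. \<pi> ! i a < \<pi> ! i b \<longleftrightarrow> \<rho> ! a < \<rho> ! b))"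

definition avoids :: "nat list \<Rightarrow> nat list \<Rightarrow> bool" where
  "avoids \<pi> \<rho> \<longleftrightarrow> \<not> contains_pattern \<pi> \<rho>"

definition ddes :: "nat list \<Rightarrow> nat" where
  "ddes \<pi> = card {i. i + 2 < length \<pi> \<and> \<pi> ! i > \<pi> ! (i + 1) \<and> \<pi> ! (i + 1) > \<pi> ! (i + 2)}"

definition a_ddes :: "nat list set \<Rightarrow> nat \<Rightarrow> nat \<Rightarrow> nat" where
  "a_ddes P n k =
     card {\<pi> \<in> permutations_of_set {1..n}. (\<forall>\<rho>\<in>P. avoids \<pi> \<rho>) \<and> ddes \<pi> = k}"

end

theory Submission
  imports Defs "HOL-Computational_Algebra.Polynomial"
begin

text \<open>
  A permutation avoids 123 and 132 iff every letter has at most one larger letter to its right, so it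
  starts with the largest letter \<open>m\<close> or the second largest letter \<open>s\<close>, and what follows is again such an
  arrangement. Split the arrangements of an \<open>n\<close>-element set into those starting with \<open>m\<close>, those
  starting with an ascent (equivalently with \<open>s m\<close>), and the rest, and let \<open>M\<^sub>n\<close>, \<open>A\<^sub>n\<close>, \<open>R\<^sub>n\<close> be the
  generating polynomials of the number of double descents in a variable \<open>X\<close>. Removing the first
  letter gives \<open>M\<^sub>n = A\<^sub>n\<^sub>-\<^sub>1 + X (M\<^sub>n\<^sub>-\<^sub>1 + R\<^sub>n\<^sub>-\<^sub>1)\<close>, \<open>A\<^sub>n = M\<^sub>n\<^sub>-\<^sub>1\<close> and \<open>R\<^sub>n = A\<^sub>n\<^sub>-\<^sub>1 + X R\<^sub>n\<^sub>-\<^sub>1\<close>, hence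
  \<open>M\<^sub>n = (1 + X)\<^sup>n\<^sup>-\<^sup>2\<close> and \<open>A\<^sub>n = R\<^sub>n = (1 + X)\<^sup>n\<^sup>-\<^sup>3\<close> for \<open>n \<ge> 3\<close>.
\<close>

section \<open>Avoidance of 123 and 132 as a condition on larger letters to the right\<close>

lemma all_less_3_iff: "(\<forall>a<3. P a) \<longleftrightarrow> P 0 \<and> P 1 \<and> P (2 :: nat)"
  by (auto simp: All_less_Suc numeral_3_eq_3 numeral_2_eq_2)

lemma strict_mono_on_less_3_iff:
  "strict_mono_on {..<3} (i :: nat \<Rightarrow> nat) \<longleftrightarrow> i 0 < i 1 \<and> i 1 < i 2" (is "?L = ?R")
proof
  assume ?R
  show ?L
  proof (rule strict_mono_onI)
    fix a b :: nat
    assume "a \<in> {..<3}" "b \<in> {..<3}" "a < b"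
    then have "a = 0 \<and> b = 1 \<or> a = 0 \<and> b = 2 \<or> a = 1 \<and> b = 2"
      by simp arith
    then show "i a < i b"
      using \<open>?R\<close> by (elim disjE) auto
  qed
qed (simp add: strict_mono_on_def)

lemma contains_pattern_length_3:
  "contains_pattern \<pi> [x, y, z] \<longleftrightarrow>
    (\<exists>p q r. p < q \<and> q < r \<and> r < length \<pi> \<and>
      (\<pi> ! p < \<pi> ! q \<longleftrightarrow> x < y) \<and> (\<pi> ! p < \<pi> ! r \<longleftrightarrow> x < z) \<and> (\<pi> ! q < \<pi> ! r \<longleftrightarrow> y < z) \<and>
      (\<pi> ! q < \<pi> ! p \<longleftrightarrow> y < x) \<and> (\<pi> ! r < \<pi> ! p \<longleftrightarrow> z < x) \<and> (\<pi> ! r < \<pi> ! q \<longleftrightarrow> z < y))"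
    (is "_ \<longleftrightarrow> (\<exists>p q r. ?P p q r)")
proof -
  have len: "length [x, y, z] = 3"
    by simp
  have "contains_pattern \<pi> [x, y, z] \<longleftrightarrow> (\<exists>i :: nat \<Rightarrow> nat. ?P (i 0) (i 1) (i 2))"
    unfolding contains_pattern_def len all_less_3_iff strict_mono_on_less_3_iff
    by (rule ex_cong1) auto
  also have "\<dots> \<longleftrightarrow> (\<exists>p q r. ?P p q r)"
  proof
    assume "\<exists>p q r. ?P p q r"
    then obtain p q r where "?P p q r" by blast
    then have "?P ([p, q, r] ! 0) ([p, q, r] ! 1) ([p, q, r] ! 2)"
      by simp
    then show "\<exists>i :: nat \<Rightarrow> nat. ?P (i 0) (i 1) (i 2)"
      \<comment> \<open>Only the values of the index function at 0, 1 and 2 matter, so list lookup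
        serves as a witness.\<close>
      by (rule exI[of _ "(!) [p, q, r]"])
  qed blast
  finally show ?thesis .
qed

text \<open>Phrased with letters instead of positions: the condition on the first letter then
  depends only on the set of letters that follow.\<close>

fun later_larger_unique :: "nat list \<Rightarrow> bool" where
  "later_larger_unique [] \<longleftrightarrow> True"
| "later_larger_unique (x # xs) \<longleftrightarrow>
     (\<forall>y\<in>set xs. \<forall>z\<in>set xs. x < y \<longrightarrow> x < z \<longrightarrow> y = z) \<and> later_larger_unique xs"

text \<open>A triple of positions either starts at the head (\<open>p = 0\<close>) or lies entirely
  in the tail, which matches the recursion. Distinctness translates different positions into
  different letters.\<close>

lemma later_larger_unique_iff_nth:
  assumes "distinct \<pi>"
  shows "later_larger_unique \<pi> \<longleftrightarrow>
    \<not> (\<exists>p q r. p < q \<and> q < r \<and> r < length \<pi> \<and> \<pi> ! p < \<pi> ! q \<and> \<pi> ! p < \<pi> ! r)"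
  using assms
proof (induction \<pi>)
  case Nil
  then show ?case by simp
next
  case (Cons x xs)
  have head: "(\<forall>y\<in>set xs. \<forall>z\<in>set xs. x < y \<longrightarrow> x < z \<longrightarrow> y = z) \<longleftrightarrow>
      \<not> (\<exists>q r. q < r \<and> r < length xs \<and> x < xs ! q \<and> x < xs ! r)"
    (is "?U \<longleftrightarrow> \<not> ?V")
  proof -
    have "?V" if "y \<in> set xs" "z \<in> set xs" "x < y" "x < z" "y \<noteq> z" for y z
    proof -
      obtain q r where "q < length xs" "xs ! q = y" "r < length xs" "xs ! r = z"
        using \<open>y \<in> set xs\<close> \<open>z \<in> set xs\<close> unfolding in_set_conv_nth by blast
      then show ?V
        using \<open>x < y\<close> \<open>x < z\<close> \<open>y \<noteq> z\<close> by (metis linorder_neqE_nat)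
    qed
    moreover have "\<not> ?U" if V: ?V
    proof -
      obtain q r where qr: "q < r" "r < length xs" "x < xs ! q" "x < xs ! r"
        using V by blast
      then have "xs ! q \<noteq> xs ! r"
        using Cons.prems by (simp add: nth_eq_iff_index_eq)
      moreover have "xs ! q \<in> set xs" "xs ! r \<in> set xs"
        using qr by simp_all
      ultimately show ?thesis
        using qr(3,4) by blast
    qed
    ultimately show ?thesis by blast
  qed
  have split: "(\<exists>p q r. p < q \<and> q < r \<and> r < length (x # xs) \<and>
        (x # xs) ! p < (x # xs) ! q \<and> (x # xs) ! p < (x # xs) ! r) \<longleftrightarrow>
      (\<exists>q r. q < r \<and> r < length xs \<and> x < xs ! q \<and> x < xs ! r) \<or>
      (\<exists>p q r. p < q \<and> q < r \<and> r < length xs \<and> xs ! p < xs ! q \<and> xs ! p < xs ! r)"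
    (is "?L \<longleftrightarrow> ?A \<or> ?B")
  proof
    assume ?L
    then obtain p q r where pqr: "p < q" "q < r" "r < length (x # xs)"
        "(x # xs) ! p < (x # xs) ! q" "(x # xs) ! p < (x # xs) ! r"
      by blast
    moreover obtain q' r' where "q = Suc q'" "r = Suc r'"
      using pqr(1,2) by (cases q; cases r) auto
    ultimately have qr: "q' < r'" "r' < length xs" "p < Suc q'"
        "(x # xs) ! p < xs ! q'" "(x # xs) ! p < xs ! r'"
      by simp_all
    show "?A \<or> ?B"
    proof (cases p)
      case 0
      then have ?A
        using qr by auto
      then show ?thesis ..
    next
      case (Suc p')
      then have "p' < q' \<and> q' < r' \<and> r' < length xs \<and> xs ! p' < xs ! q' \<and> xs ! p' < xs ! r'"
        using qr by simp
      then have ?B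
        by blast
      then show ?thesis ..
    qed
  next
    assume "?A \<or> ?B"
    then show ?L
    proof
      assume ?A
      then obtain q r where "q < r" "r < length xs" "x < xs ! q" "x < xs ! r" by blast
      then show ?L
        by (intro exI[of _ 0] exI[of _ "Suc q"] exI[of _ "Suc r"]) auto
    next
      assume ?B
      then obtain p q r where "p < q" "q < r" "r < length xs" "xs ! p < xs ! q" "xs ! p < xs ! r"
        by blast
      then show ?L
        by (intro exI[of _ "Suc p"] exI[of _ "Suc q"] exI[of _ "Suc r"]) auto
    qed
  qed
  have "distinct xs"
    using Cons.prems by simp
  then show ?case
    using Cons.IH head split by auto
qed

text \<open>If \<open>\<pi> ! p\<close> is smaller than two later letters, these two are in
  increasing order, which gives 123, or in decreasing order, which gives 132.\<close>

lemma avoids_123_132_iff: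
  assumes "distinct \<pi>"
  shows "(\<forall>\<rho>\<in>{[1, 2, 3], [1, 3, 2]}. avoids \<pi> \<rho>) \<longleftrightarrow> later_larger_unique \<pi>"
proof -
  have 123: "contains_pattern \<pi> [1, 2, 3] \<longleftrightarrow>
      (\<exists>p q r. p < q \<and> q < r \<and> r < length \<pi> \<and> \<pi> ! p < \<pi> ! q \<and> \<pi> ! q < \<pi> ! r)"
    unfolding contains_pattern_length_3 by (intro ex_cong1) auto
  have 132: "contains_pattern \<pi> [1, 3, 2] \<longleftrightarrow>
      (\<exists>p q r. p < q \<and> q < r \<and> r < length \<pi> \<and> \<pi> ! p < \<pi> ! r \<and> \<pi> ! r < \<pi> ! q)"
    unfolding contains_pattern_length_3 by (intro ex_cong1) auto
  have neq: "\<pi> ! q \<noteq> \<pi> ! r" if "q < r" "r < length \<pi>" for q r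
    using that assms by (simp add: nth_eq_iff_index_eq)
  have "contains_pattern \<pi> [1, 2, 3] \<or> contains_pattern \<pi> [1, 3, 2] \<longleftrightarrow>
      (\<exists>p q r. p < q \<and> q < r \<and> r < length \<pi> \<and> \<pi> ! p < \<pi> ! q \<and> \<pi> ! p < \<pi> ! r)"
    unfolding 123 132 by (meson neq linorder_neqE_nat order.strict_trans)
  then show ?thesis
    using later_larger_unique_iff_nth[OF assms] by (auto simp: avoids_def)
qed

section \<open>Double descents, and arrangements of a finite set classified by their
  beginning\<close>

lemma ddes_short: "length \<pi> < 3 \<Longrightarrow> ddes \<pi> = 0"
  by (simp add: ddes_def)

lemma ddes_Cons:
  "ddes (x # y # z # l) = (if x > y \<and> y > z then 1 else 0) + ddes (y # z # l)"
proof -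
  let ?D = "\<lambda>\<pi> :: nat list. {i. i + 2 < length \<pi> \<and> \<pi> ! i > \<pi> ! (i + 1) \<and> \<pi> ! (i + 1) > \<pi> ! (i + 2)}"
  have "i \<in> ?D (x # y # z # l) \<longleftrightarrow>
      i \<in> (if x > y \<and> y > z then {0} else {}) \<union> Suc ` ?D (y # z # l)" for i
    by (cases i) auto
  then have "?D (x # y # z # l) = (if x > y \<and> y > z then {0} else {}) \<union> Suc ` ?D (y # z # l)"
    by blast
  moreover have "finite (?D (y # z # l))"
    by (rule finite_subset[of _ "{..<length (y # z # l)}"]) auto
  ultimately show ?thesis
    unfolding ddes_def by (simp add: card_insert_if card_image image_iff)
qed

text \<open>Arbitrary letter sets are allowed because deleting the second largest letter of
  \<open>{1..n}\<close> does not leave an initial segment; this avoids relabelling.\<close>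

definition avoiders :: "nat set \<Rightarrow> nat list set" where
  "avoiders S = {\<pi> \<in> permutations_of_set S. later_larger_unique \<pi>}"

definition avoiders_max :: "nat set \<Rightarrow> nat list set" where
  "avoiders_max S = {\<pi> \<in> avoiders S. hd \<pi> = Max S}"

text \<open>Position 1 exists only if \<open>S\<close> has at least two elements, hence the later
  bounds on \<open>card S\<close>.\<close>

definition avoiders_asc :: "nat set \<Rightarrow> nat list set" where
  "avoiders_asc S = {\<pi> \<in> avoiders S. \<pi> ! 0 < \<pi> ! 1}"

definition avoiders_rest :: "nat set \<Rightarrow> nat list set" where
  "avoiders_rest S = avoiders S - avoiders_max S - avoiders_asc S"

lemma finite_avoiders [simp]:
  "finite (avoiders S)" "finite (avoiders_max S)" "finite (avoiders_asc S)" "finite (avoiders_rest S)"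
  by (simp_all add: avoiders_def avoiders_max_def avoiders_asc_def avoiders_rest_def)

lemma avoiders_length: "\<pi> \<in> avoiders S \<Longrightarrow> length \<pi> = card S"
  by (auto simp: avoiders_def permutations_of_set_def distinct_card)

lemma Cons_in_avoiders_iff:
  "x # \<tau> \<in> avoiders S \<longleftrightarrow>
    x \<in> S \<and> \<tau> \<in> avoiders (S - {x}) \<and> (\<forall>y\<in>S. \<forall>z\<in>S. x < y \<longrightarrow> x < z \<longrightarrow> y = z)"
  by (auto simp: avoiders_def permutations_of_set_def)

lemma avoiders_Nil_iff: "[] \<in> avoiders S \<longleftrightarrow> S = {}"
  by (auto simp: avoiders_def permutations_of_set_def)

lemma avoiders_first:
  assumes "\<tau> \<in> avoiders T" "T \<noteq> {}"
  shows "hd \<tau> = \<tau> ! 0" "\<tau> ! 0 \<in> T"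
proof -
  have "\<tau> \<noteq> []"
    using assms by (auto simp: avoiders_Nil_iff)
  moreover have "set \<tau> = T"
    using assms by (simp add: avoiders_def permutations_of_set_def)
  ultimately show "hd \<tau> = \<tau> ! 0" "\<tau> ! 0 \<in> T"
    by (auto simp: hd_conv_nth)
qed

lemma avoiders_max_asc_disjoint:
  assumes "card S \<ge> 2"
  shows "avoiders_max S \<inter> avoiders_asc S = {}"
proof -
  have "\<not> \<pi> ! 0 < \<pi> ! 1" if \<pi>: "\<pi> \<in> avoiders S" "hd \<pi> = Max S" for \<pi>
  proof -
    have "length \<pi> = card S" "set \<pi> = S"
      using \<pi>(1) by (auto simp: avoiders_def permutations_of_set_def distinct_card)
    then have "\<pi> ! 1 \<in> S"
      using assms by (metis Suc_1 Suc_le_lessD nth_mem One_nat_def)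
    moreover have "finite S" "S \<noteq> {}"
      using assms by (auto intro: card_ge_0_finite)
    ultimately show ?thesis
      using avoiders_first(1)[OF \<pi>(1)] \<pi>(2) Max_ge[of S "\<pi> ! 1"] by simp
  qed
  then show ?thesis
    by (auto simp: avoiders_max_def avoiders_asc_def)
qed

section \<open>Removal of the first letter, which is one of the two largest\<close>

locale two_largest =
  fixes S :: "nat set" and m s :: nat
  assumes fin: "finite S" and mem: "m \<in> S" "s \<in> S" and less: "s < m"
    and le: "\<And>y. y \<in> S \<Longrightarrow> y = m \<or> y \<le> s"
begin

lemma Max_eq: "Max S = m"
  using fin mem less le by (intro Max_eqI) fastforce+

lemma Max_remove: "Max (S - {s}) = m"
  using fin mem less le by (intro Max_eqI) fastforce+

lemma remove_not_empty: "S - {m} \<noteq> {}" "S - {s} \<noteq> {}"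
  using mem less by auto

text \<open>Any other letter has both \<open>s\<close> and \<open>m\<close> above it, whereas only
  \<open>m\<close> can lie above \<open>s\<close>, and nothing lies above \<open>m\<close>.\<close>

lemma larger_unique_iff:
  assumes "x \<in> S"
  shows "(\<forall>y\<in>S. \<forall>z\<in>S. x < y \<longrightarrow> x < z \<longrightarrow> y = z) \<longleftrightarrow> x = m \<or> x = s"
proof
  assume "\<forall>y\<in>S. \<forall>z\<in>S. x < y \<longrightarrow> x < z \<longrightarrow> y = z"
  then show "x = m \<or> x = s"
    using assms mem less le[OF assms] by (metis less_le order.strict_trans)
next
  assume x: "x = m \<or> x = s"
  have "y = m" if "y \<in> S" "x < y" for y
    using le[OF \<open>y \<in> S\<close>] \<open>x < y\<close> x less by auto
  then show "\<forall>y\<in>S. \<forall>z\<in>S. x < y \<longrightarrow> x < z \<longrightarrow> y = z"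
    by blast
qed

lemma Cons_in_avoiders:
  "x # \<tau> \<in> avoiders S \<longleftrightarrow> (x = m \<or> x = s) \<and> \<tau> \<in> avoiders (S - {x})"
  using larger_unique_iff mem by (auto simp: Cons_in_avoiders_iff)

lemma avoiders_eq: "avoiders S = (#) m ` avoiders (S - {m}) \<union> (#) s ` avoiders (S - {s})"
proof -
  have "\<pi> \<in> avoiders S \<longleftrightarrow> \<pi> \<in> (#) m ` avoiders (S - {m}) \<union> (#) s ` avoiders (S - {s})" for \<pi>
    using mem less by (cases \<pi>) (auto simp: avoiders_Nil_iff Cons_in_avoiders)
  then show ?thesis by blast
qed

lemma avoiders_max_eq: "avoiders_max S = (#) m ` avoiders (S - {m})"
  using less by (auto simp: avoiders_max_def avoiders_eq Max_eq)

lemma second_asc_iff: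
  assumes "\<tau> \<in> avoiders (S - {s})"
  shows "s < \<tau> ! 0 \<longleftrightarrow> hd \<tau> = m"
  using avoiders_first[OF assms remove_not_empty(2)] le[of "\<tau> ! 0"] less by auto

lemma nth0_less_largest:
  assumes "\<tau> \<in> avoiders (S - {m})"
  shows "\<tau> ! 0 < m"
  using avoiders_first(2)[OF assms remove_not_empty(1)] le[of "\<tau> ! 0"] less by auto

text \<open>A list starting with \<open>m\<close> descends at once; one starting with
  \<open>s\<close> ascends only to \<open>m\<close>, the sole larger letter.\<close>

lemma avoiders_asc_eq: "avoiders_asc S = (#) s ` avoiders_max (S - {s})"
proof -
  have "\<pi> \<in> avoiders_max (S - {s}) \<longleftrightarrow> \<pi> \<in> avoiders (S - {s}) \<and> s < \<pi> ! 0" for \<pi>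
    using second_asc_iff by (auto simp: avoiders_max_def Max_remove)
  moreover have "\<not> m < \<pi> ! 0" if "\<pi> \<in> avoiders (S - {m})" for \<pi>
    using nth0_less_largest[OF that] by simp
  ultimately show ?thesis
    by (auto simp: avoiders_asc_def avoiders_eq)
qed

lemma avoiders_rest_eq:
  "avoiders_rest S = (#) s ` (avoiders (S - {s}) - avoiders_max (S - {s}))"
proof -
  have "(#) m ` A \<inter> (#) s ` B = {}" for A B
    using less by auto
  then show ?thesis
    unfolding avoiders_rest_def avoiders_max_eq avoiders_asc_eq
    by (subst avoiders_eq) blast
qed

end

lemma two_largestE:
  assumes "card S \<ge> 2"
  obtains m s where "two_largest S m s"
proof -
  have fin: "finite S"
    using assms by (metis card.infinite not_numeral_le_zero)
  define m where "m = Max S"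
  define s where "s = Max (S - {m})"
  have "S \<noteq> {}" using assms by auto
  then have m: "m \<in> S" using fin by (simp add: m_def)
  have "S - {m} \<noteq> {}"
    using assms m fin by (metis One_nat_def Suc_1 card_Suc_Diff1 card.empty not_less_eq_eq order_refl)
  then have s: "s \<in> S - {m}"
    unfolding s_def using fin by (metis Max_in finite_Diff)
  have "s < m"
    using s fin by (simp add: m_def less_le)
  moreover have "y = m \<or> y \<le> s" if "y \<in> S" for y
    using that fin by (cases "y = m") (simp_all add: s_def)
  ultimately have "two_largest S m s"
    using fin m s by unfold_locales auto
  then show ?thesis by (rule that)
qed

section \<open>Generating polynomials of the number of double descents\<close>

definition ddes_poly :: "nat list set \<Rightarrow> int poly" where
  "ddes_poly A = (\<Sum>\<pi>\<in>A. monom 1 (ddes \<pi>))"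

lemma ddes_poly_union:
  "finite A \<Longrightarrow> finite B \<Longrightarrow> A \<inter> B = {} \<Longrightarrow> ddes_poly (A \<union> B) = ddes_poly A + ddes_poly B"
  by (simp add: ddes_poly_def sum.union_disjoint)

lemma coeff_ddes_poly:
  assumes "finite A"
  shows "coeff (ddes_poly A) k = int (card {\<pi> \<in> A. ddes \<pi> = k})"
proof -
  have "coeff (ddes_poly A) k = (\<Sum>\<pi>\<in>A. if ddes \<pi> = k then 1 else 0)"
    by (simp add: ddes_poly_def coeff_sum)
  also have "\<dots> = (\<Sum>\<pi>\<in>{\<pi> \<in> A. ddes \<pi> = k}. 1)"
    by (rule sum.inter_filter[OF assms, symmetric])
  finally show ?thesis by simp
qed

lemma ddes_poly_Cons_same:
  assumes "\<And>\<pi>. \<pi> \<in> A \<Longrightarrow> ddes (x # \<pi>) = ddes \<pi>"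
  shows "ddes_poly ((#) x ` A) = ddes_poly A"
  by (simp add: ddes_poly_def sum.reindex assms)

text \<open>\<open>[:0, 1:]\<close> is the variable \<open>X\<close>; it records the one new double
  descent.\<close>

lemma ddes_poly_Cons_Suc:
  assumes "\<And>\<pi>. \<pi> \<in> A \<Longrightarrow> ddes (x # \<pi>) = Suc (ddes \<pi>)"
  shows "ddes_poly ((#) x ` A) = [:0, 1:] * ddes_poly A"
  by (simp add: ddes_poly_def sum.reindex assms sum_distrib_left monom_Suc)

lemma avoiders_split:
  "avoiders S = avoiders_max S \<union> avoiders_asc S \<union> avoiders_rest S"
  by (auto simp: avoiders_rest_def avoiders_max_def avoiders_asc_def)

text \<open>The only new candidate is formed by \<open>x\<close> and the first two letters of
  \<open>\<tau>\<close>. As these two letters differ, they descend exactly when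
  \<open>\<tau>\<close> is outside \<open>avoiders_asc T\<close>.\<close>

lemma ddes_Cons_avoider:
  assumes "\<tau> \<in> avoiders T" "card T \<ge> 2"
  shows "ddes (x # \<tau>) = (if x > \<tau> ! 0 \<and> \<tau> \<notin> avoiders_asc T then 1 else 0) + ddes \<tau>"
proof -
  obtain y z l where \<tau>: "\<tau> = y # z # l"
    using avoiders_length[OF assms(1)] assms(2) by (cases \<tau> rule: list.exhaust; cases "tl \<tau>") auto
  have "distinct \<tau>"
    using assms by (auto simp: avoiders_def permutations_of_set_def)
  then have "\<tau> \<notin> avoiders_asc T \<longleftrightarrow> y > z"
    using assms by (auto simp: avoiders_asc_def \<tau>)
  then show ?thesis
    by (simp add: \<tau> ddes_Cons)
qed

section \<open>Recurrences for the three polynomials\<close>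

context two_largest
begin

lemma nth0_less_second:
  assumes "\<tau> \<in> avoiders (S - {s}) - avoiders_max (S - {s})"
  shows "\<tau> ! 0 < s"
proof -
  have \<tau>: "\<tau> \<in> avoiders (S - {s})" "hd \<tau> \<noteq> m"
    using assms by (auto simp: avoiders_max_def Max_remove)
  then show ?thesis
    using avoiders_first[OF \<tau>(1) remove_not_empty(2)] le[of "\<tau> ! 0"] by auto
qed

text \<open>The letter \<open>m\<close> exceeds its successor, so a double descent is created unless
  the tail starts with an ascent.\<close>

lemma ddes_poly_max:
  assumes "card S \<ge> 3"
  shows "ddes_poly (avoiders_max S) = ddes_poly (avoiders_asc (S - {m})) +
    [:0, 1:] * (ddes_poly (avoiders_max (S - {m})) + ddes_poly (avoiders_rest (S - {m})))"
proof -
  let ?T = "S - {m}"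
  have T: "card ?T \<ge> 2"
    using assms mem by simp
  \<comment> \<open>These are the tails that start with a descent.\<close>
  let ?D = "avoiders_max ?T \<union> avoiders_rest ?T"
  have "avoiders ?T = avoiders_asc ?T \<union> ?D"
    using avoiders_split by blast
  moreover have disj: "avoiders_asc ?T \<inter> ?D = {}" "avoiders_max ?T \<inter> avoiders_rest ?T = {}"
    using avoiders_max_asc_disjoint[OF T] by (auto simp: avoiders_rest_def)
  ultimately have "avoiders_max S = (#) m ` avoiders_asc ?T \<union> (#) m ` ?D"
    by (simp add: avoiders_max_eq image_Un)
  moreover have "(#) m ` avoiders_asc ?T \<inter> (#) m ` ?D = {}"
    using disj by blast
  ultimately have "ddes_poly (avoiders_max S) =
      ddes_poly ((#) m ` avoiders_asc ?T) + ddes_poly ((#) m ` ?D)"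
    by (simp add: ddes_poly_union)
  also have "ddes_poly ((#) m ` avoiders_asc ?T) = ddes_poly (avoiders_asc ?T)"
    by (rule ddes_poly_Cons_same) (subst ddes_Cons_avoider[OF _ T]; simp add: avoiders_asc_def)
  also have "ddes_poly ((#) m ` ?D) = [:0, 1:] * ddes_poly ?D"
  proof (rule ddes_poly_Cons_Suc)
    fix \<pi> assume \<pi>: "\<pi> \<in> ?D"
    then have "\<pi> \<in> avoiders ?T" "\<pi> \<notin> avoiders_asc ?T"
      using disj by (auto simp: avoiders_max_def avoiders_rest_def)
    then show "ddes (m # \<pi>) = Suc (ddes \<pi>)"
      using ddes_Cons_avoider[OF _ T] nth0_less_largest by simp
  qed
  also have "ddes_poly ?D = ddes_poly (avoiders_max ?T) + ddes_poly (avoiders_rest ?T)"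
    using disj by (simp add: ddes_poly_union)
  finally show ?thesis .
qed

text \<open>Here \<open>s\<close> is followed by \<open>m\<close>, so the initial ascent creates no
  double descent.\<close>

lemma ddes_poly_asc:
  assumes "card S \<ge> 3"
  shows "ddes_poly (avoiders_asc S) = ddes_poly (avoiders_max (S - {s}))"
  unfolding avoiders_asc_eq
proof (rule ddes_poly_Cons_same)
  have T: "card (S - {s}) \<ge> 2"
    using assms mem by simp
  fix \<pi> assume "\<pi> \<in> avoiders_max (S - {s})"
  then have \<pi>: "\<pi> \<in> avoiders (S - {s})" "hd \<pi> = m"
    by (auto simp: avoiders_max_def Max_remove)
  then show "ddes (s # \<pi>) = ddes \<pi>"
    using ddes_Cons_avoider[OF \<pi>(1) T] second_asc_iff[OF \<pi>(1)] by simp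
qed

text \<open>The tail does not start with \<open>m\<close>, so its first letter is below
  \<open>s\<close>. A double descent is therefore created unless the tail starts with an ascent, and
  no \<open>avoiders_max\<close> term occurs.\<close>

lemma ddes_poly_rest:
  assumes "card S \<ge> 3"
  shows "ddes_poly (avoiders_rest S) =
    ddes_poly (avoiders_asc (S - {s})) + [:0, 1:] * ddes_poly (avoiders_rest (S - {s}))"
proof -
  let ?T = "S - {s}"
  have T: "card ?T \<ge> 2"
    using assms mem by simp
  have "avoiders ?T - avoiders_max ?T = avoiders_asc ?T \<union> avoiders_rest ?T"
    using avoiders_max_asc_disjoint[OF T] avoiders_split[of ?T] by (auto simp: avoiders_rest_def)
  then have eq: "avoiders_rest S = (#) s ` avoiders_asc ?T \<union> (#) s ` avoiders_rest ?T"
    by (simp add: avoiders_rest_eq image_Un)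
  moreover have "(#) s ` avoiders_asc ?T \<inter> (#) s ` avoiders_rest ?T = {}"
    by (auto simp: avoiders_rest_def)
  ultimately have "ddes_poly (avoiders_rest S) =
      ddes_poly ((#) s ` avoiders_asc ?T) + ddes_poly ((#) s ` avoiders_rest ?T)"
    by (simp add: ddes_poly_union)
  also have "ddes_poly ((#) s ` avoiders_asc ?T) = ddes_poly (avoiders_asc ?T)"
    by (rule ddes_poly_Cons_same) (subst ddes_Cons_avoider[OF _ T]; simp add: avoiders_asc_def)
  also have "ddes_poly ((#) s ` avoiders_rest ?T) = [:0, 1:] * ddes_poly (avoiders_rest ?T)"
    by (rule ddes_poly_Cons_Suc)
       (use ddes_Cons_avoider[OF _ T] nth0_less_second in \<open>simp add: avoiders_rest_def\<close>)
  finally show ?thesis .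
qed

end

section \<open>Initial values, closed forms and the final count\<close>

lemma avoiders_singleton: "avoiders {a} = {[a]}"
  by (auto simp: avoiders_def)

text \<open>The two arrangements are \<open>[m, s]\<close> and \<open>[s, m]\<close>. The value 0 of
  the rest class does not fit the closed form, which starts only at three letters.\<close>

lemma ddes_poly_card_2:
  assumes "card S = 2"
  shows "ddes_poly (avoiders_max S) = 1" "ddes_poly (avoiders_asc S) = 1"
    "ddes_poly (avoiders_rest S) = 0"
proof -
  obtain m s where "two_largest S m s"
    using two_largestE assms by (metis order_refl)
  then interpret two_largest S m s .
  have "S = {m, s}"
    using assms mem less fin by (intro card_seteq[symmetric]) auto
  then have "S - {m} = {s}" "S - {s} = {m}"
    using less by auto
  moreover have "avoiders_max {m} = {[m]}"
    by (auto simp: avoiders_max_def avoiders_singleton)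
  ultimately have "avoiders_max S = {[m, s]}" "avoiders_asc S = {[s, m]}" "avoiders_rest S = {}"
    by (simp_all add: avoiders_max_eq avoiders_asc_eq avoiders_rest_eq avoiders_singleton)
  then show "ddes_poly (avoiders_max S) = 1" "ddes_poly (avoiders_asc S) = 1"
      "ddes_poly (avoiders_rest S) = 0"
    by (simp_all add: ddes_poly_def ddes_short)
qed

lemma ddes_poly_avoiders:
  assumes "card S = n + 3"
  shows "ddes_poly (avoiders_max S) = [:1, 1:] ^ (n + 1) \<and>
    ddes_poly (avoiders_asc S) = [:1, 1:] ^ n \<and> ddes_poly (avoiders_rest S) = [:1, 1:] ^ n"
  using assms
proof (induction n arbitrary: S)
  case 0
  then obtain m s where "two_largest S m s"
    using two_largestE[of S] by auto
  then interpret two_largest S m s .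
  \<comment> \<open>The recurrences give \<open>1 + X * (1 + 0)\<close>, \<open>1\<close> and
    \<open>1 + X * 0\<close> for the three classes.\<close>
  have "card (S - {m}) = 2" "card (S - {s}) = 2" "card S \<ge> 3"
    using 0 mem by simp_all
  then show ?case
    by (simp add: ddes_poly_max ddes_poly_asc ddes_poly_rest ddes_poly_card_2 one_pCons)
next
  case (Suc n)
  then obtain m s where "two_largest S m s"
    using two_largestE[of S] by auto
  then interpret two_largest S m s .
  have card: "card (S - {m}) = n + 3" "card (S - {s}) = n + 3" "card S \<ge> 3"
    using Suc.prems mem by simp_all
  \<comment> \<open>With \<open>B = 1 + X\<close>, the induction step rests on
    \<open>B^n + X * (B^(n+1) + B^n) = B^(n+2)\<close> and \<open>B^n + X * B^n = B^(n+1)\<close>.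
    Writing \<open>B\<close> as a sum lets distributivity prove both.\<close>
  have X: "[:1, 1:] = 1 + [:0, 1 :: int:]"
    by (simp add: one_pCons)
  show ?case
    using Suc.IH[OF card(1)] Suc.IH[OF card(2)]
    by (simp only: ddes_poly_max ddes_poly_asc ddes_poly_rest card(3) X)
       (simp only: power_Suc power_add power_one_right algebra_simps mult_1 mult_1_right
          Suc_eq_plus1 add.assoc)
qed

theorem proposition16:
  fixes n k :: nat
  assumes "n \<ge> 3"
  shows "a_ddes {[1, 2, 3], [1, 3, 2]} n k = ((n - 2) choose k) + 2 * ((n - 3) choose k)"
proof -
  let ?S = "{1..n}"
  have "card ?S = (n - 3) + 3"
    using assms by simp
  note polys = ddes_poly_avoiders[OF this]
  \<comment> \<open>For \<open>k > j\<close> the degree is below \<open>k\<close>, so both sides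
    vanish.\<close>
  have coeff: "coeff ([:1, 1 :: int:] ^ j) k = int (j choose k)" for j
    by (cases "k \<le> j") (simp_all add: coeff_linear_poly_power coeff_eq_0 degree_linear_power binomial_eq_0)
  have "{\<pi> \<in> permutations_of_set ?S. (\<forall>\<rho>\<in>{[1, 2, 3], [1, 3, 2]}. avoids \<pi> \<rho>) \<and> ddes \<pi> = k} =
      {\<pi> \<in> avoiders ?S. ddes \<pi> = k}"
    using avoids_123_132_iff permutations_of_setD(2) unfolding avoiders_def by blast
  then have "int (a_ddes {[1, 2, 3], [1, 3, 2]} n k) = coeff (ddes_poly (avoiders ?S)) k"
    by (simp add: a_ddes_def coeff_ddes_poly)
  also have "ddes_poly (avoiders ?S) = ddes_poly (avoiders_max ?S \<union> avoiders_asc ?S) +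
      ddes_poly (avoiders_rest ?S)"
    by (subst avoiders_split, rule ddes_poly_union) (auto simp: avoiders_rest_def)
  also have "ddes_poly (avoiders_max ?S \<union> avoiders_asc ?S) =
      ddes_poly (avoiders_max ?S) + ddes_poly (avoiders_asc ?S)"
    using avoiders_max_asc_disjoint[of ?S] assms by (intro ddes_poly_union) auto
  \<comment> \<open>The lists starting with the maximum contribute the first binomial coefficient;
    the other two classes contribute one equal term each.\<close>
  finally have "int (a_ddes {[1, 2, 3], [1, 3, 2]} n k) =
      int ((n - 3 + 1) choose k) + int ((n - 3) choose k) + int ((n - 3) choose k)"
    by (simp only: polys coeff coeff_add)
  moreover have "n - 3 + 1 = n - 2"
    using assms by simp
  ultimately show ?thesis by simp
qed

end
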